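(* For any prime power $q$, there exist unit weighing matrices $W_1,\ldots,W_q$ of order $q^2$ and weight $q$ that are mutually quasi-unbiased for the parameters $(q^2,q,q^2,1)$ and such that, for any distinct $i,j\in\{1,\ldots,q\}$, $W_iW_j^*$ is a Bush-type $(q^2,q)$-Butson Hadamard matrix.
   Context: Let $\mathbb{T}=\{c\in\mathbb{C}:|c|=1\}$ and $W^*$ the conjugate transpose. A unit weighing matrix of order $n$ and weight $k$ is an $n\times n$ matrix $W$ with entries in $\{0\}\cup\mathbb{T}$ with $WW^*=kI_n$. Unit weighing matrices $W_1,W_2$ of order $n$ and weight $k$ are quasi-unbiased for parameters $(n,k,l,a)$ if $\frac1{\sqrt a}W_1W_2^*$ is a unit weighing matrix of order $n$ and weight $l$; mutually quasi-unbiased means pairwise. A complex Hadamard matrix of order $n$ is a unit weighing matrix of order $n$ and weight $n$; an $(n,m)$-Butson Hadamard matrix is a complex Hadamard matrix of order $n$ all of whose entries are $m$-th roots of unity. A complex Hadamard matrix $H$ of order $n^2$ is of Bush-type if, partitioned into $n\times n$ blocks $H=(H_{ij})_{i,j=1}^n$, it satisfies $H_{ii}=J_n$ for all $i$ and $H_{ij}J_n=J_nH_{ij}=O_n$ for all $i\neq j$, where $J_n$ is the all-ones matrix and $O_n$ the zero matrix. *)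

theory Defs
  imports Complex_Main "HOL-Computational_Algebra.Primes"
begin

text \<open>Square complex matrices of order n are represented as functions
  nat \<Rightarrow> nat \<Rightarrow> complex, only the entries with indices < n being relevant.\<close>

type_synonym cmat = "nat \<Rightarrow> nat \<Rightarrow> complex"

definition prime_power :: "nat \<Rightarrow> bool" where
  "prime_power q \<longleftrightarrow> (\<exists>p k. prime p \<and> k \<ge> 1 \<and> q = p ^ k)"

definition mat_mult :: "nat \<Rightarrow> cmat \<Rightarrow> cmat \<Rightarrow> cmat" where
  "mat_mult n A B = (\<lambda>i j. \<Sum>l<n. A i l * B l j)"

definition conj_transp :: "cmat \<Rightarrow> cmat" where
  "conj_transp A = (\<lambda>i j. cnj (A j i))"

definition mat_scale :: "complex \<Rightarrow> cmat \<Rightarrow> cmat" where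
  "mat_scale c A = (\<lambda>i j. c * A i j)"

definition unit_weighing :: "nat \<Rightarrow> nat \<Rightarrow> cmat \<Rightarrow> bool" where
  "unit_weighing n k W \<longleftrightarrow>
     (\<forall>i<n. \<forall>j<n. W i j = 0 \<or> cmod (W i j) = 1) \<and>
     (\<forall>i<n. \<forall>j<n. mat_mult n W (conj_transp W) i j = (if i = j then of_nat k else 0))"

definition quasi_unbiased :: "nat \<Rightarrow> nat \<Rightarrow> nat \<Rightarrow> nat \<Rightarrow> cmat \<Rightarrow> cmat \<Rightarrow> bool" where
  "quasi_unbiased n k l a W1 W2 \<longleftrightarrow>
     unit_weighing n k W1 \<and> unit_weighing n k W2 \<and>
     unit_weighing n l (mat_scale (1 / complex_of_real (sqrt (real a))) (mat_mult n W1 (conj_transp W2)))"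

definition complex_hadamard :: "nat \<Rightarrow> cmat \<Rightarrow> bool" where
  "complex_hadamard n H \<longleftrightarrow> unit_weighing n n H"

definition butson_hadamard :: "nat \<Rightarrow> nat \<Rightarrow> cmat \<Rightarrow> bool" where
  "butson_hadamard n m H \<longleftrightarrow> complex_hadamard n H \<and> (\<forall>i<n. \<forall>j<n. H i j ^ m = 1)"

text \<open>Bush-type complex Hadamard matrix of order n^2, with n\<times>n blocks
  H_{ij}(a,b) = H (i*n+a) (j*n+b).\<close>
definition bush_type :: "nat \<Rightarrow> cmat \<Rightarrow> bool" where
  "bush_type n H \<longleftrightarrow> complex_hadamard (n^2) H \<and>
     (\<forall>i<n. \<forall>a<n. \<forall>b<n. H (i*n+a) (i*n+b) = 1) \<and>
     (\<forall>i<n. \<forall>j<n. i \<noteq> j \<longrightarrow>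
        (\<forall>a<n. (\<Sum>b<n. H (i*n+a) (j*n+b)) = 0) \<and>
        (\<forall>b<n. (\<Sum>a<n. H (i*n+a) (j*n+b)) = 0))"

end

theory Submission
  imports Defs "HOL-Computational_Algebra.Computational_Algebra" "HOL-Library.Real_Mod"
begin

text \<open>Let \<open>\<psi>\<close> be a nontrivial additive character of the field \<open>F\<close> with \<open>q\<close> elements. Index rows
  by pairs \<open>(i, a)\<close> and columns by pairs \<open>(x, y)\<close> over \<open>F\<close>; for each slope \<open>m\<close> let row \<open>(i, a)\<close> of
  \<open>W\<^sub>m\<close> be supported on the line \<open>y = m x + a\<close>, with entry \<open>\<psi>(i x)\<close> there. Since lines of distinct
  slopes meet in exactly one point, for \<open>m \<noteq> m'\<close> the entry of \<open>W\<^sub>m W\<^sub>m'\<^sup>*\<close> at \<open>(i, a), (j, b)\<close> is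
  \<open>\<psi>((i - j) (b - a) / (m - m'))\<close>, and everything follows from the orthogonality of characters.

  There is no HOL type for \<open>F\<close> with \<open>q\<close> a variable, so \<open>F\<close> is represented as a residue ring
  \<open>\<int>[X] / P\<close>: \<open>P\<close> is a maximal ideal containing \<open>p\<close> and a prime factor \<open>f\<close> of \<open>X\<^sup>n - 1\<close>,
  \<open>n = q - 1\<close>, that vanishes at a primitive complex \<open>n\<close>-th root of unity. Then \<open>X\<close> has order exactly
  \<open>n\<close> modulo \<open>P\<close>, which gives \<open>q\<close> distinct classes, and every class satisfies \<open>g\<^sup>q = g\<close>, so there are
  no others. The character is built from the trace \<open>\<Sum>i<k. g^(p^i)\<close>.\<close>

section \<open>Congruence modulo a prime ideal\<close>

locale prime_ideal =
  fixes P :: "'a :: comm_ring_1 set"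
  assumes zero_mem: "0 \<in> P"
    and add_mem: "x \<in> P \<Longrightarrow> y \<in> P \<Longrightarrow> x + y \<in> P"
    and mult_mem: "x \<in> P \<Longrightarrow> r * x \<in> P"
    and one_notin: "1 \<notin> P"
    and prime_mem: "x * y \<in> P \<Longrightarrow> x \<in> P \<or> y \<in> P"
begin

definition eqv :: "'a \<Rightarrow> 'a \<Rightarrow> bool" (infix "\<approx>" 50)
  where "x \<approx> y \<longleftrightarrow> x - y \<in> P"

lemma uminus_mem: "x \<in> P \<Longrightarrow> - x \<in> P"
  using mult_mem[of x "-1"] by simp

lemma diff_mem: "x \<in> P \<Longrightarrow> y \<in> P \<Longrightarrow> x - y \<in> P"
  using add_mem[of x "- y"] uminus_mem[of y] by simp

lemma eqv_refl [simp, intro]: "x \<approx> x"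
  by (simp add: eqv_def zero_mem)

lemma eqv_sym: "x \<approx> y \<Longrightarrow> y \<approx> x"
  using uminus_mem[of "x - y"] by (simp add: eqv_def)

lemma eqv_trans [trans]: "x \<approx> y \<Longrightarrow> y \<approx> z \<Longrightarrow> x \<approx> z"
  using add_mem[of "x - y" "y - z"] by (simp add: eqv_def)

lemma eqv_zero_iff: "x \<approx> 0 \<longleftrightarrow> x \<in> P"
  by (simp add: eqv_def)

lemma eqv_mem_iff: "x \<approx> y \<Longrightarrow> x \<in> P \<longleftrightarrow> y \<in> P"
  using eqv_sym eqv_trans eqv_zero_iff by blast

lemma eqv_add: "x \<approx> x' \<Longrightarrow> y \<approx> y' \<Longrightarrow> x + y \<approx> x' + y'"
  using add_mem[of "x - x'" "y - y'"] by (simp add: eqv_def algebra_simps)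

lemma eqv_mult: assumes "x \<approx> x'" "y \<approx> y'" shows "x * y \<approx> x' * y'"
proof -
  have "y * (x - x') + x' * (y - y') \<in> P"
    using assms by (intro add_mem mult_mem) (auto simp: eqv_def)
  then show ?thesis by (simp add: eqv_def algebra_simps)
qed

lemma eqv_power: "x \<approx> x' \<Longrightarrow> x ^ n \<approx> x' ^ n"
  by (induction n) (auto intro: eqv_mult)

lemma eqv_sum: "(\<And>i. i \<in> A \<Longrightarrow> f i \<approx> g i) \<Longrightarrow> sum f A \<approx> sum g A"
  by (induction A rule: infinite_finite_induct) (auto intro: eqv_add)

lemma eqv_mult_cancel: "c \<notin> P \<Longrightarrow> c * x \<approx> c * y \<Longrightarrow> x \<approx> y"
  using prime_mem[of c "x - y"] by (auto simp: eqv_def algebra_simps)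

text \<open>The residue ring is a domain, so a polynomial with more roots than its degree is zero
  there. With no quotient type at hand, roots are arguments whose value lies in \<open>P\<close>,
  and being zero means that all coefficients lie in \<open>P\<close>. Each induction step splits off
  one linear factor.\<close>

lemma many_roots_imp_coeff_mem:
  assumes "finite S" "\<And>s. s \<in> S \<Longrightarrow> poly A s \<in> P"
    and "\<And>s t. s \<in> S \<Longrightarrow> t \<in> S \<Longrightarrow> s \<approx> t \<Longrightarrow> s = t"
    and "degree A < card S"
  shows "coeff A i \<in> P"
  using assms
proof (induction S arbitrary: A i rule: finite_induct)
  case empty
  then show ?case by simp
next
  case (insert s S)
  define B where "B = synthetic_div A s"
  have A: "[:-s, 1:] * B + [:poly A s:] = A"
    unfolding B_def by (rule synthetic_div_correct')
  have As: "poly A s \<in> P" using insert.prems by simp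
  show ?case
  proof (cases "degree A = 0")
    case True
    then obtain c where c: "A = [:c:]" by (meson degree_eq_zeroE)
    with As show ?thesis by (auto simp: coeff_pCons zero_mem split: nat.split)
  next
    case False
    have B: "coeff B j \<in> P" for j
    proof (rule insert.IH)
      fix t assume t: "t \<in> S"
      have "poly A t = (t - s) * poly B t + poly A s"
        by (subst A[symmetric]) (simp add: algebra_simps)
      then have "(t - s) * poly B t \<in> P"
        using diff_mem[of "poly A t" "poly A s"] As insert.prems(1)[of t] t by simp
      \<comment> \<open>Distinct elements of \<open>S\<close> are incongruent, so primality of
        \<open>P\<close> passes the root \<open>t\<close> from \<open>A\<close> on to the quotient
        \<open>B\<close>.\<close>
      moreover have "t - s \<notin> P"
        using insert.prems(2)[of t s] insert.hyps t by (auto simp: eqv_def)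
      ultimately show "poly B t \<in> P" using prime_mem by blast
    next
      show "degree B < card S"
        using False insert.prems(3) insert.hyps by (simp add: B_def degree_synthetic_div)
    qed (use insert.prems in auto)
    have "coeff A i = - s * coeff B i + coeff (pCons 0 B) i + coeff [:poly A s:] i"
      by (subst A[symmetric]) (simp add: algebra_simps flip: coeff_add)
    moreover have "coeff (pCons 0 B) i \<in> P" "coeff [:poly A s:] i \<in> P"
      using B As zero_mem by (auto simp: coeff_pCons split: nat.split)
    ultimately show ?thesis using add_mem mult_mem B by metis
  qed
qed

end

section \<open>Characteristic p: the prime field and the Frobenius map\<close>

locale residue_char = prime_ideal P for P :: "'a :: comm_ring_1 set" +
  fixes p :: nat
  assumes prime_p: "prime p" and p_mem: "of_nat p \<in> P"
begin

text \<open>If \<open>p\<close> did not divide \<open>z\<close>, a Bezout combination of the two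
  would put 1 into \<open>P\<close>. Hence the integers modulo \<open>P\<close> form a copy of the
  prime field.\<close>

lemma of_int_mem_iff: "of_int z \<in> P \<longleftrightarrow> int p dvd z"
proof
  assume "int p dvd z"
  then obtain w where "z = w * int p" by (metis dvdE mult.commute)
  then show "of_int z \<in> P" using mult_mem[OF p_mem, of "of_int w"] by simp
next
  assume z: "of_int z \<in> P"
  show "int p dvd z"
  proof (rule ccontr)
    assume "\<not> int p dvd z"
    then have "coprime (int p) z" using prime_p by (simp add: prime_imp_coprime)
    then obtain u v where uv: "u * int p + v * z = 1"
      by (metis bezout_int coprime_imp_gcd_eq_1)
    have "of_int u * of_nat p + of_int v * of_int z \<in> P"
      by (intro add_mem mult_mem p_mem z)
    also have "of_int u * of_nat p + of_int v * of_int z = (of_int (u * int p + v * z) :: 'a)"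
      by simp
    finally show False using one_notin by (simp add: uv)
  qed
qed

lemma eqv_of_int_iff: "of_int a \<approx> of_int b \<longleftrightarrow> int p dvd a - b"
  unfolding eqv_def by (simp flip: of_int_diff add: of_int_mem_iff)

text \<open>All binomial coefficients except the two outer ones are multiples of \<open>p\<close>,
  hence lie in \<open>P\<close>.\<close>

lemma frobenius_add: "(x + y) ^ p \<approx> x ^ p + y ^ p"
proof -
  have p: "p > 1" using prime_p prime_gt_1_nat by simp
  have "(x + y) ^ p = (\<Sum>i\<le>p. of_nat (p choose i) * x ^ i * y ^ (p - i))"
    by (rule binomial_ring)
  also have "\<dots> \<approx> (\<Sum>i\<le>p. (if i = 0 then y ^ p else 0) + (if i = p then x ^ p else 0))"
  proof (rule eqv_sum)
    fix i assume i: "i \<in> {..p}"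
    show "of_nat (p choose i) * x ^ i * y ^ (p - i)
        \<approx> (if i = 0 then y ^ p else 0) + (if i = p then x ^ p else 0)"
    proof (cases "i = 0 \<or> i = p")
      case False
      with i have "p dvd (p choose i)" by (intro dvd_choose_prime) (auto simp: prime_p)
      then obtain c where "p choose i = p * c" by auto
      then have "of_nat (p choose i) * x ^ i * y ^ (p - i)
          = (of_nat c * x ^ i * y ^ (p - i)) * of_nat p"
        by (simp add: mult_ac)
      then show ?thesis using False mult_mem[OF p_mem] by (simp add: eqv_zero_iff)
    qed (use p in auto)
  qed
  also have "(\<Sum>i\<le>p. (if i = 0 then y ^ p else 0) + (if i = p then x ^ p else 0)) = x ^ p + y ^ p"
    by (simp add: sum.distrib)
  finally show ?thesis .
qed

lemma frobenius_pow_add: "(x + y) ^ (p ^ i) \<approx> x ^ (p ^ i) + y ^ (p ^ i)"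
proof (induction i)
  case (Suc i)
  have "(x + y) ^ (p ^ Suc i) = ((x + y) ^ (p ^ i)) ^ p"
    by (simp add: power_mult [symmetric] mult.commute)
  also have "\<dots> \<approx> (x ^ (p ^ i) + y ^ (p ^ i)) ^ p"
    by (intro eqv_power Suc.IH)
  also have "\<dots> \<approx> (x ^ (p ^ i)) ^ p + (y ^ (p ^ i)) ^ p"
    by (rule frobenius_add)
  also have "\<dots> = x ^ (p ^ Suc i) + y ^ (p ^ Suc i)"
    by (simp add: power_mult [symmetric] mult.commute)
  finally show ?case .
qed simp

lemma frobenius_sum: "sum f A ^ p \<approx> (\<Sum>i\<in>A. f i ^ p)"
proof (induction A rule: infinite_finite_induct)
  case (insert a A)
  have "sum f (insert a A) ^ p = (f a + sum f A) ^ p" using insert.hyps by simp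
  also have "\<dots> \<approx> f a ^ p + sum f A ^ p" by (rule frobenius_add)
  also have "\<dots> \<approx> f a ^ p + (\<Sum>i\<in>A. f i ^ p)" by (intro eqv_add eqv_refl insert.IH)
  finally show ?case using insert.hyps by simp
qed (use prime_gt_0_nat[OF prime_p] in \<open>auto simp: power_0_left\<close>)

lemma fermat_of_int: "of_int c ^ p ^ i \<approx> of_int c"
proof -
  have pos: "p ^ i > 0" using prime_gt_0_nat[OF prime_p] by simp
  \<comment> \<open>Additivity of the \<open>p^i\<close>-th power makes the claims for
    \<open>c\<close> and \<open>c + 1\<close> equivalent, so induction from 0 runs in both
    directions and reaches negative integers too.\<close>
  have step: "(of_int c ^ p ^ i \<approx> of_int c) \<longleftrightarrow> (of_int (c + 1) ^ p ^ i \<approx> of_int (c + 1))" for c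
  proof -
    have "of_int (c + 1) ^ p ^ i \<approx> of_int c ^ p ^ i + 1"
      using frobenius_pow_add[of "of_int c" 1 i] by simp
    then have "(of_int (c + 1) ^ p ^ i \<approx> of_int (c + 1)) \<longleftrightarrow> of_int c ^ p ^ i + 1 \<approx> of_int (c + 1)"
      using eqv_sym eqv_trans by blast
    then show ?thesis by (simp add: eqv_def)
  qed
  show ?thesis
  proof (induction c rule: int_induct[where k = 0])
    case base
    show ?case using pos by (simp only: of_int_0 zero_power eqv_refl)
  next
    case (step1 c)
    then show ?case using step[of c] by blast
  next
    case (step2 c)
    then show ?case using step[of "c - 1"] by simp
  qed
qed

text \<open>\<open>X^p - X\<close> already has the \<open>p\<close> roots
  \<open>0, ..., p - 1\<close>; a fixed point outside the prime field would be one root too many and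
  would force the leading coefficient 1 into \<open>P\<close>.\<close>

lemma frobenius_fixed_imp_of_nat:
  assumes "y ^ p \<approx> y"
  shows "\<exists>m. y \<approx> of_nat m"
proof (rule ccontr)
  assume no: "\<nexists>m. y \<approx> of_nat m"
  have p: "p > 1" using prime_p prime_gt_1_nat by simp
  define S where "S = insert y (of_nat ` {..<p} :: 'a set)"
  define A :: "'a poly" where "A = monom 1 p - monom 1 1"
  have eq: "m = n" if "m < p" "n < p" "(of_nat m :: 'a) \<approx> of_nat n" for m n
  proof -
    have "int p dvd int m - int n" using that(3) eqv_of_int_iff[of "int m" "int n"] by simp
    moreover have "\<bar>int m - int n\<bar> < int p" using that by linarith
    ultimately have "int m - int n = 0" using dvd_imp_le_int[of "int m - int n" "int p"] by fastforce
    then show "m = n" by simp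
  qed
  have inj: "inj_on (of_nat :: nat \<Rightarrow> 'a) {..<p}"
    using eq by (auto intro!: inj_onI)
  have y: "y \<notin> of_nat ` {..<p}" using no by auto
  have "coeff A p \<in> P"
  proof (rule many_roots_imp_coeff_mem[where S = S])
    fix s assume "s \<in> S"
    moreover have "of_nat m ^ p \<approx> of_nat m" for m
      using fermat_of_int[of "int m" 1] by simp
    ultimately have "s ^ p \<approx> s" using assms by (auto simp: S_def)
    then show "poly A s \<in> P" by (simp add: A_def poly_monom eqv_def)
  next
    fix s t assume "s \<in> S" "t \<in> S" "s \<approx> t"
    then consider "s = y" "t = y" | m where "s = y" "t = of_nat m" | m where "t = y" "s = of_nat m"
      | m n where "s = of_nat m" "t = of_nat n" "m < p" "n < p"
      unfolding S_def by blast
    then show "s = t"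
    proof cases
      case 4
      then show ?thesis using eq[of m n] \<open>s \<approx> t\<close> by simp
    qed (use no \<open>s \<approx> t\<close> eqv_sym in auto)
  next
    have "degree A \<le> p" unfolding A_def using p
      by (intro degree_diff_le) (auto intro: order.trans[OF degree_monom_le])
    moreover have "card S = Suc p" using inj y by (simp add: S_def card_image)
    ultimately show "degree A < card S" by simp
  qed (auto simp: S_def)
  then show False using p one_notin by (simp add: A_def)
qed

end

text \<open>\<open>r\<close> enumerates \<open>q\<close> incongruent representatives. That they
  exhaust the residue ring follows from \<open>frob\<close>, so the residue ring is the field with
  \<open>q\<close> elements.\<close>

locale finite_residue_field = residue_char P p for P :: "'a :: comm_ring_1 set" and p +
  fixes k :: nat and q :: nat and r :: "nat \<Rightarrow> 'a"
  assumes k: "k \<ge> 1" and q: "q = p ^ k"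
    and frob: "x ^ q \<approx> x"
    and r_inj: "i < q \<Longrightarrow> j < q \<Longrightarrow> r i \<approx> r j \<Longrightarrow> i = j"
begin

lemma q_gt_1: "q > 1"
  using k prime_gt_1_nat[OF prime_p] unfolding q by (intro one_less_power) auto

lemma inj_on_r: "inj_on r {..<q}"
  using r_inj by (auto simp: inj_on_def)

lemma r_surj: "\<exists>i<q. x \<approx> r i"
proof (rule ccontr)
  assume no: "\<not> (\<exists>i<q. x \<approx> r i)"
  define S where "S = insert x (r ` {..<q})"
  define A :: "'a poly" where "A = monom 1 q - monom 1 1"
  have "coeff A q \<in> P"
  proof (rule many_roots_imp_coeff_mem[where S = S])
    fix s assume "s \<in> S"
    show "poly A s \<in> P" using frob[of s] by (simp add: A_def poly_monom eqv_def)
  next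
    fix s t assume "s \<in> S" "t \<in> S" "s \<approx> t"
    then show "s = t" using no r_inj eqv_sym unfolding S_def by fast
  next
    have "degree A \<le> q" unfolding A_def using q_gt_1
      by (intro degree_diff_le) (auto intro: order.trans[OF degree_monom_le])
    moreover have "x \<notin> r ` {..<q}" using no by auto
    ultimately show "degree A < card S" by (simp add: S_def card_image inj_on_r)
  qed (auto simp: S_def)
  then show False using q_gt_1 one_notin by (simp add: A_def)
qed

lemma inverse_ex: assumes "c \<notin> P" shows "\<exists>d. d * c \<approx> 1"
proof -
  \<comment> \<open>The inverse of \<open>c\<close> is \<open>c ^ (q - 2)\<close>, because
    \<open>c ^ q\<close> is congruent to \<open>c\<close>.\<close>
  have "c * (c ^ (q - 2) * c) \<approx> c * 1"
  proof -
    have "q = Suc (Suc (q - 2))" using q_gt_1 by simp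
    then have "c * (c ^ (q - 2) * c) = c ^ q" by (metis power_Suc power_Suc2)
    then show ?thesis using frob[of c] by simp
  qed
  then show ?thesis using eqv_mult_cancel[OF assms] by blast
qed

section \<open>The absolute trace to the prime field and the character built from it\<close>

definition trace :: "'a \<Rightarrow> 'a" where "trace x = (\<Sum>i<k. x ^ p ^ i)"

lemma trace_add: "trace (x + y) \<approx> trace x + trace y"
proof -
  have "trace (x + y) \<approx> (\<Sum>i<k. x ^ p ^ i + y ^ p ^ i)"
    unfolding trace_def by (intro eqv_sum frobenius_pow_add)
  then show ?thesis by (simp add: trace_def sum.distrib)
qed

lemma trace_mem: assumes "x \<in> P" shows "trace x \<in> P"
proof -
  have "trace x \<approx> (\<Sum>i<k. 0 ^ p ^ i)"
    unfolding trace_def using assms by (intro eqv_sum eqv_power) (simp add: eqv_zero_iff)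
  then show ?thesis using prime_gt_0_nat[OF prime_p] by (simp add: power_0_left eqv_zero_iff)
qed

text \<open>Raising to the power \<open>p\<close> shifts the summands by one place, and the last
  one, \<open>x ^ q\<close>, wraps around to \<open>x\<close>. Hence traces are congruent to
  integers.\<close>

lemma trace_frobenius: "trace x ^ p \<approx> trace x"
proof -
  obtain k' where k': "k = Suc k'" using k by (cases k) auto
  have "trace x ^ p \<approx> (\<Sum>i<k. (x ^ p ^ i) ^ p)"
    unfolding trace_def by (rule frobenius_sum)
  also have "\<dots> = (\<Sum>i<k. x ^ p ^ Suc i)"
    by (simp add: power_mult [symmetric] mult.commute)
  also have "\<dots> = (\<Sum>i<k'. x ^ p ^ Suc i) + x ^ q" by (simp add: k' q)
  also have "\<dots> \<approx> (\<Sum>i<k'. x ^ p ^ Suc i) + x" by (intro eqv_add eqv_refl frob)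
  also have "\<dots> = trace x" 
    unfolding trace_def using k' by (simp add: sum.lessThan_Suc_shift add.commute del: sum.lessThan_Suc)
  finally show ?thesis .
qed

text \<open>The trace is a polynomial of degree below \<open>q\<close> with leading coefficient 1,
  so it cannot vanish on all \<open>q\<close> classes.\<close>

lemma trace_nonzero: "\<exists>x. trace x \<notin> P"
proof (rule ccontr)
  assume all: "\<nexists>x. trace x \<notin> P"
  have p: "p > 1" using prime_p prime_gt_1_nat by simp
  define A :: "'a poly" where "A = (\<Sum>i<k. monom 1 (p ^ i))"
  have "coeff A (p ^ (k - 1)) \<in> P"
  proof (rule many_roots_imp_coeff_mem[where S = "r ` {..<q}"])
    fix s show "poly A s \<in> P" using all by (simp add: A_def poly_sum poly_monom trace_def)
  next
    have "degree A \<le> p ^ (k - 1)" unfolding A_def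
      by (intro degree_sum_le) (use p in \<open>auto intro!: order.trans[OF degree_monom_le] power_increasing\<close>)
    also have "\<dots> < q" using p k unfolding q by (intro power_strict_increasing) auto
    finally show "degree A < card (r ` {..<q})" by (simp add: card_image inj_on_r)
  qed (use r_inj in auto)
  moreover have "coeff A (p ^ (k - 1)) = 1"
  proof -
    have "coeff A (p ^ (k - 1)) = (\<Sum>i<k. if i = k - 1 then 1 else 0)"
      unfolding A_def coeff_sum using p by (intro sum.cong) auto
    then show ?thesis using k by simp
  qed
  ultimately show False using one_notin by simp
qed

text \<open>The character is \<open>x \<mapsto> exp(2 \<pi> i Tr(x) / p)\<close>. Its values are
  \<open>p\<close>-th roots of unity, and \<open>p\<close> divides \<open>q\<close>.\<close>

lemma additive_character_ex:
  "\<exists>\<psi> :: 'a \<Rightarrow> complex. (\<forall>x y. \<psi> (x + y) = \<psi> x * \<psi> y) \<and> (\<forall>x\<in>P. \<psi> x = 1) \<and>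
     (\<exists>x. \<psi> x \<noteq> 1) \<and> (\<forall>x. \<psi> x ^ q = 1)"
proof -
  have p: "p > 1" using prime_p prime_gt_1_nat by simp
  have "\<forall>x. \<exists>m. trace x \<approx> of_nat m"
    using frobenius_fixed_imp_of_nat trace_frobenius by blast
  \<comment> \<open>The integer \<open>m x\<close> is determined only modulo \<open>p\<close>; since
    \<open>e\<close> has period \<open>p\<close>, the choice does not affect the character.\<close>
  then obtain m where m: "\<And>x. trace x \<approx> of_nat (m x)" by metis
  define e where "e z = cis (2 * pi * (real_of_int z / p))" for z
  have e_add: "e (a + b) = e a * e b" for a b
    by (simp add: e_def cis_mult add_divide_distrib distrib_left)
  have e_1: "e z = 1 \<longleftrightarrow> int p dvd z" for z
  proof
    assume "e z = 1"
    then obtain n where "2 * pi * (real_of_int z / p) = of_int n * (2 * pi)"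
      unfolding e_def cis_eq_1_iff by blast
    then have "real_of_int z = of_int (n * int p)" using p by (simp add: field_simps)
    then have "z = n * int p" by (simp only: of_int_eq_iff)
    then show "int p dvd z" by simp
  next
    assume "int p dvd z"
    then obtain w where "z = int p * w" by blast
    then have "2 * pi * (real_of_int z / p) = of_int w * (2 * pi)" using p by simp
    then show "e z = 1" unfolding e_def cis_eq_1_iff by blast
  qed
  have "e (int (m (x + y))) = e (int (m x)) * e (int (m y))" for x y
  proof -
    have "of_nat (m (x + y)) \<approx> trace (x + y)" by (rule eqv_sym[OF m])
    also note trace_add
    also have "trace x + trace y \<approx> of_nat (m x) + of_nat (m y)" by (intro eqv_add m)
    finally have "of_int (int (m (x + y))) \<approx> of_int (int (m x) + int (m y))" by simp
    then have "e (int (m (x + y)) - (int (m x) + int (m y))) = 1"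
      by (simp only: eqv_of_int_iff e_1)
    then have "e (int (m (x + y)) - (int (m x) + int (m y)) + (int (m x) + int (m y)))
        = e (int (m x) + int (m y))"
      by (simp only: e_add mult_1)
    then show ?thesis by (simp add: e_add)
  qed
  moreover have "e (int (m x)) = 1 \<longleftrightarrow> trace x \<in> P" for x
    unfolding e_1 using eqv_mem_iff[OF m] of_int_mem_iff[of "int (m x)"] by simp
  moreover have "e z ^ q = 1" for z
  proof -
    have "e z ^ n = e (of_nat n * z)" for n
      by (induction n) (auto simp: e_add distrib_right, simp add: e_def)
    moreover have "p dvd q" using k unfolding q by (simp add: dvd_power)
    ultimately show ?thesis by (simp add: e_1)
  qed
  ultimately show ?thesis using trace_mem trace_nonzero
    by (intro exI[of _ "\<lambda>x. e (int (m x))"]) auto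
qed

end

section \<open>Existence of finite residue fields\<close>

text \<open>Zorn's lemma yields a maximal proper ideal containing \<open>I\<close>, and maximal
  ideals are prime.\<close>

lemma prime_ideal_exists:
  fixes I :: "'a :: comm_ring_1 set"
  assumes I: "0 \<in> I" "\<And>x y. x \<in> I \<Longrightarrow> y \<in> I \<Longrightarrow> x + y \<in> I" "\<And>x r. x \<in> I \<Longrightarrow> r * x \<in> I"
    and "1 \<notin> I"
  shows "\<exists>P. I \<subseteq> P \<and> prime_ideal P"
proof -
  define \<A> where "\<A> = {J. I \<subseteq> J \<and> (\<forall>x\<in>J. \<forall>y\<in>J. x + y \<in> J) \<and> (\<forall>x\<in>J. \<forall>r. r * x \<in> J) \<and> 1 \<notin> J}"
  have "\<exists>M\<in>\<A>. \<forall>X\<in>\<A>. M \<subseteq> X \<longrightarrow> X = M"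
  proof (rule subset_Zorn_nonempty)
    have "I \<in> \<A>" using assms by (simp add: \<A>_def)
    then show "\<A> \<noteq> {}" by blast
  next
    fix \<C> assume ne: "\<C> \<noteq> {}" and ch: "subset.chain \<A> \<C>"
    have sub: "\<C> \<subseteq> \<A>" and tot: "\<And>X Y. X \<in> \<C> \<Longrightarrow> Y \<in> \<C> \<Longrightarrow> X \<subseteq> Y \<or> Y \<subseteq> X"
      using ch by (auto simp: subset_chain_def)
    have "x + y \<in> \<Union>\<C>" if xy: "x \<in> \<Union>\<C>" "y \<in> \<Union>\<C>" for x y
    proof -
      obtain X Y where XY: "X \<in> \<C>" "Y \<in> \<C>" "x \<in> X" "y \<in> Y" using xy by blast
      then obtain Z where "Z \<in> \<C>" "x \<in> Z" "y \<in> Z" using tot[of X Y] by blast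
      then show ?thesis using sub unfolding \<A>_def by blast
    qed
    moreover have "r * x \<in> \<Union>\<C>" if "x \<in> \<Union>\<C>" for x r
      using that sub unfolding \<A>_def by blast
    moreover have "I \<subseteq> \<Union>\<C>" using ne sub unfolding \<A>_def by blast
    moreover have "1 \<notin> \<Union>\<C>" using sub unfolding \<A>_def by blast
    ultimately show "\<Union>\<C> \<in> \<A>" unfolding \<A>_def by blast
  qed
  then obtain M where M: "M \<in> \<A>" and max: "\<And>X. X \<in> \<A> \<Longrightarrow> M \<subseteq> X \<Longrightarrow> X = M" by blast
  have add: "x + y \<in> M" if "x \<in> M" "y \<in> M" for x y using M that by (auto simp: \<A>_def)
  have mult: "r * x \<in> M" if "x \<in> M" for x r using M that by (auto simp: \<A>_def)
  have zero: "0 \<in> M" and one: "1 \<notin> M" and IM: "I \<subseteq> M" using M I(1) by (auto simp: \<A>_def)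
  \<comment> \<open>By maximality, \<open>M\<close> together with any \<open>a\<close> outside it
    generates the whole ring.\<close>
  have comax: "\<exists>m\<in>M. \<exists>r. m + r * a = 1" if a: "a \<notin> M" for a
  proof (rule ccontr)
    assume no: "\<not> ?thesis"
    define X where "X = {x. \<exists>m\<in>M. \<exists>r. x = m + r * a}"
    have MX: "M \<subseteq> X" unfolding X_def by (auto intro!: exI[of _ 0])
    have aX: "a \<in> X" unfolding X_def using zero by (auto intro!: bexI[of _ 0] exI[of _ 1])
    have "x + y \<in> X" if xy: "x \<in> X" "y \<in> X" for x y
    proof -
      obtain m r where "m \<in> M" "x = m + r * a" using xy unfolding X_def by blast
      moreover obtain m' r' where "m' \<in> M" "y = m' + r' * a" using xy unfolding X_def by blast
      ultimately have "m + m' \<in> M" "x + y = (m + m') + (r + r') * a"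
        by (auto simp: add algebra_simps)
      then show ?thesis unfolding X_def by blast
    qed
    moreover have "s * x \<in> X" if x: "x \<in> X" for x s
    proof -
      obtain m r where "m \<in> M" "x = m + r * a" using x unfolding X_def by blast
      then have "s * m \<in> M" "s * x = s * m + (s * r) * a"
        by (auto simp: distrib_left mult.assoc intro: mult)
      then show ?thesis unfolding X_def by blast
    qed
    moreover have "1 \<notin> X" using no unfolding X_def by force
    ultimately have "X \<in> \<A>" using MX IM unfolding \<A>_def by blast
    then show False using max MX aX a by blast
  qed
  have "prime_ideal M"
  proof
    fix a b assume ab: "a * b \<in> M"
    show "a \<in> M \<or> b \<in> M"
    proof (rule ccontr)
      assume "\<not> ?thesis"
      then obtain m r where mr: "m \<in> M" "m + r * a = 1" and b: "b \<notin> M" using comax by blast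
      \<comment> \<open>This element is \<open>b\<close> itself, as
        \<open>m + r * a = 1\<close>.\<close>
      have "b * m + r * (a * b) \<in> M" by (intro add mult mr ab)
      also have "b * m + r * (a * b) = b * (m + r * a)" by (simp add: algebra_simps)
      finally show False using mr b by simp
    qed
  qed (use add mult zero one in auto)
  then show ?thesis using IM by blast
qed

section \<open>Integer polynomials and roots of unity\<close>

definition int_poly_eval :: "int poly \<Rightarrow> complex \<Rightarrow> complex" where
  "int_poly_eval f z = poly (map_poly of_int f) z"

lemma int_poly_eval_mult: "int_poly_eval (f * g) z = int_poly_eval f z * int_poly_eval g z"
proof -
  have "map_poly of_int (f * g) = (map_poly of_int f * map_poly of_int g :: complex poly)"
    by (rule poly_eqI) (simp add: coeff_map_poly coeff_mult)
  then show ?thesis by (simp add: int_poly_eval_def)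
qed

lemma int_poly_eval_monom_minus_1: "int_poly_eval (monom 1 n - 1) z = z ^ n - 1"
proof -
  have "map_poly of_int (monom 1 n - 1) = (monom 1 n - 1 :: complex poly)"
    by (rule poly_eqI) (simp add: coeff_map_poly)
  then show ?thesis by (simp add: int_poly_eval_def poly_monom)
qed

text \<open>Evaluation is multiplicative, so a zero of a product is a zero of some factor; a unit
  has no zeros. The induction runs over the factorisation into primes in
  \<open>\<int>[X]\<close>.\<close>

lemma prime_factor_with_root:
  "A \<noteq> 0 \<Longrightarrow> int_poly_eval A z = 0 \<Longrightarrow> \<exists>f. prime f \<and> f dvd A \<and> int_poly_eval f z = 0"
proof (induction A rule: prime_divisors_induct)
  case (unit x)
  then obtain y where "x * y = 1" by (metis dvdE)
  then have "int_poly_eval x z * int_poly_eval y z = int_poly_eval 1 z"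
    by (simp flip: int_poly_eval_mult)
  with unit show ?case by (simp add: int_poly_eval_def)
next
  case (factor p x)
  then show ?case by (auto simp: int_poly_eval_mult intro: dvd_mult)
qed simp

lemma primitive_root_of_unity:
  fixes d n :: nat
  assumes "d > 0" "d < n"
  shows "cis (2 * pi / n) ^ d \<noteq> 1"
proof
  assume "cis (2 * pi / n) ^ d = 1"
  then have "cis (real d * (2 * pi / n)) = 1" by (simp add: Complex.DeMoivre)
  then obtain m where "real d * (2 * pi / n) = of_int m * (2 * pi)" unfolding cis_eq_1_iff by blast
  then have "real_of_int (int d) = of_int (m * int n)" using assms by (simp add: field_simps)
  then have "int d = m * int n" by (simp only: of_int_eq_iff)
  then have "int n dvd int d" by simp
  then show False using assms by (auto dest: dvd_imp_le)
qed

text \<open>This makes the ideal generated by \<open>p\<close> and \<open>f\<close> proper.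
  Comparing top coefficients shows that \<open>p\<close> divides the leading coefficient of
  \<open>b\<close>, so the leading term of \<open>b\<close> can be moved into the multiple of
  \<open>p\<close>. Descent on the degree of \<open>b\<close> ends with \<open>p\<close> dividing
  1.\<close>

lemma ideal_prime_poly_proper:
  fixes f :: "int poly"
  assumes p: "p > 1" and lc: "is_unit (lead_coeff f)" and deg: "degree f > 0"
  shows "of_nat p * a + f * b \<noteq> 1"
proof (induction "degree b" arbitrary: a b rule: less_induct)
  case less
  show ?case
  proof
    assume eq: "of_nat p * a + f * b = 1"
    have cp: "coeff (of_nat p * g) i = int p * coeff g i" for g :: "int poly" and i
      by (simp add: of_nat_poly)
    have [simp]: "f \<noteq> 0" using deg by auto
    have "b \<noteq> 0"
    proof
      assume "b = 0"
      then have "int p * coeff a 0 = 1" using arg_cong[OF eq, of "\<lambda>g. coeff g 0"] cp[of a 0] by simp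
      then show False using p by (simp add: zmult_eq_1_iff)
    qed
    \<comment> \<open>\<open>degree f > 0\<close> places this coefficient above the constant term of
      1.\<close>
    have "coeff (of_nat p * a + f * b) (degree f + degree b) = 0" unfolding eq using deg by simp
    then have "int p * coeff a (degree f + degree b) + lead_coeff f * lead_coeff b = 0"
      by (simp add: cp coeff_mult_degree_sum)
    then have "lead_coeff f * lead_coeff b = int p * - coeff a (degree f + degree b)" by simp
    then have "int p dvd lead_coeff f * lead_coeff b" by (rule dvdI)
    then have "int p dvd lead_coeff b"
      using lc by (simp add: dvd_mult_unit_iff')
    then obtain c where c: "lead_coeff b = int p * c" by blast
    define b' where "b' = b - monom (lead_coeff b) (degree b)"
    have eq': "of_nat p * (a + f * monom c (degree b)) + f * b' = 1"
    proof -
      have "monom (lead_coeff b) (degree b) = of_nat p * monom c (degree b)"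
        unfolding c by (rule poly_eqI) (simp add: cp)
      then show ?thesis unfolding b'_def eq[symmetric] by (simp add: algebra_simps)
    qed
    show False
    proof (cases "degree b = 0")
      case True
      then have "b' = 0" unfolding b'_def by (auto simp: monom_0 elim: degree_eq_zeroE)
      then have "int p * coeff (a + f * monom c (degree b)) 0 = 1"
        using arg_cong[OF eq', of "\<lambda>g. coeff g 0"] cp[of _ 0] by simp
      then show False using p by (simp add: zmult_eq_1_iff)
    next
      case False
      have "degree b' < degree b" unfolding b'_def using False
        by (intro degree_lessI) (auto simp: coeff_eq_0)
      then show False using less eq' by blast
    qed
  qed
qed

lemma finite_residue_field_exists:
  assumes p: "prime p" and k: "k \<ge> 1"
  shows "\<exists>(P :: int poly set) r. finite_residue_field P p k (p ^ k) r"
proof -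
  define q where "q = p ^ k"
  define n where "n = q - 1"
  have p1: "p > 1" using p prime_gt_1_nat by simp
  have q1: "q > 1" using p1 k unfolding q_def by (intro one_less_power) auto
  have n: "n \<ge> 1" "q = Suc n" using q1 by (auto simp: n_def)
  define X :: "int poly" where "X = monom 1 1"
  have X_pow: "X ^ i = monom 1 i" for i by (simp add: X_def monom_power)
  define z where "z = cis (2 * pi / n)"
  have zn: "z ^ n = 1" using n unfolding z_def by (simp add: Complex.DeMoivre)
  have deg_Xn: "degree (X ^ n - 1) = n" and lc_Xn: "lead_coeff (X ^ n - 1) = 1"
  proof -
    have "degree (X ^ n - 1) \<le> n" unfolding X_pow
      by (intro degree_diff_le) (auto intro: order.trans[OF degree_monom_le])
    moreover have c: "coeff (X ^ n - 1) n = 1" using n by (simp add: X_pow)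
    ultimately show d: "degree (X ^ n - 1) = n"
      by (intro antisym le_degree) auto
    show "lead_coeff (X ^ n - 1) = 1" using c d by simp
  qed
  have "X ^ n - 1 \<noteq> 0" using deg_Xn n by auto
  moreover have "int_poly_eval (X ^ n - 1) z = 0"
    using zn by (simp add: X_pow int_poly_eval_monom_minus_1)
  \<comment> \<open>Since \<open>z\<close> is a primitive \<open>n\<close>-th root of unity,
    \<open>f\<close> divides no \<open>X ^ d - 1\<close> with \<open>0 < d < n\<close>; up to sign
    it is the \<open>n\<close>-th cyclotomic polynomial.\<close>
  ultimately obtain f where f: "prime f" "f dvd X ^ n - 1" "int_poly_eval f z = 0"
    using prime_factor_with_root by blast
  have lc_f: "is_unit (lead_coeff f)"
  proof -
    obtain h where "X ^ n - 1 = f * h" using f by blast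
    then have "lead_coeff f * lead_coeff h = 1" using lc_Xn by (simp add: lead_coeff_mult)
    then show ?thesis by (metis dvdI)
  qed
  have deg_f: "degree f > 0"
  proof (rule ccontr)
    assume "\<not> ?thesis"
    then obtain c where "f = [:c:]" by (auto elim: degree_eq_zeroE)
    then have "is_unit f" using lc_f by (simp add: is_unit_const_poly_iff)
    then show False using f(1) not_prime_unit by blast
  qed
  define I where "I = {g. \<exists>a b. g = of_nat p * a + f * b}"
  have "\<exists>P. I \<subseteq> P \<and> prime_ideal P"
  proof (rule prime_ideal_exists)
    show "0 \<in> I" unfolding I_def by (auto intro!: exI[of _ 0])
  next
    fix x y assume "x \<in> I" "y \<in> I"
    then obtain a b a' b' where "x = of_nat p * a + f * b" "y = of_nat p * a' + f * b'"
      unfolding I_def by blast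
    then have "x + y = of_nat p * (a + a') + f * (b + b')" by (simp add: algebra_simps)
    then show "x + y \<in> I" unfolding I_def by blast
  next
    fix x r assume "x \<in> I"
    then obtain a b where "x = of_nat p * a + f * b" unfolding I_def by blast
    then have "r * x = of_nat p * (r * a) + f * (r * b)" by (simp add: algebra_simps)
    then show "r * x \<in> I" unfolding I_def by blast
  next
    show "1 \<notin> I" unfolding I_def using ideal_prime_poly_proper[OF p1 lc_f deg_f] by auto
  qed
  then obtain P where IP: "I \<subseteq> P" and "prime_ideal P" by blast
  interpret prime_ideal P by fact
  have "of_nat p * 1 + f * 0 \<in> I" "of_nat p * 0 + f * 1 \<in> I" unfolding I_def by blast+
  then have pP: "of_nat p \<in> P" and fP: "f \<in> P" using IP by auto
  interpret residue_char P p by standard (use p pP in auto)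
  have dvd_mem: "h \<in> P" if "f dvd h" for h
    using that mult_mem[OF fP] by (auto simp: mult.commute)
  have Xn: "eqv (X ^ n) 1" using dvd_mem[OF f(2)] by (simp add: eqv_def)
  \<comment> \<open>\<open>n = q - 1\<close> is congruent to -1 modulo \<open>p\<close>. This makes
    \<open>X ^ n - 1\<close> separable modulo \<open>P\<close>.\<close>
  have nP: "of_nat n \<notin> P"
  proof
    assume "of_nat n \<in> P"
    then have "int p dvd int n" using of_int_mem_iff[of "int n"] by simp
    moreover have "p dvd Suc n" using k n unfolding q_def by (metis dvd_power gr0I not_one_le_zero)
    ultimately have "p dvd Suc n - n" by (intro dvd_diff_nat) auto
    then show False using p1 by simp
  qed
  have XP: "X \<notin> P"
  proof
    assume "X \<in> P"
    then have "X ^ n \<in> P" using n mult_mem[of X "X ^ (n - 1)"] power_minus_mult[of n X] by simp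
    then show False using Xn one_notin eqv_mem_iff by blast
  qed
  \<comment> \<open>Write \<open>X ^ n - 1 = (X ^ d - 1) * h\<close>. The prime \<open>f\<close>
    must divide \<open>h\<close>; if \<open>X ^ d - 1\<close> lay in \<open>P\<close> as well, the
    class of \<open>X\<close> would be a double root of a separable polynomial.\<close>
  have no_divisor: "\<not> eqv (X ^ d) 1" if d: "d dvd n" "d > 0" "d < n" for d
  proof
    assume Xd: "eqv (X ^ d) 1"
    obtain e where e: "n = d * e" using d by blast
    have "X ^ d - 1 dvd X ^ n - 1"
      unfolding e power_mult by (simp add: power_diff_1_eq)
    then obtain h where h: "X ^ n - 1 = (X ^ d - 1) * h" by blast
    have "\<not> f dvd X ^ d - 1"
    proof
      assume "f dvd X ^ d - 1"
      then obtain g where "X ^ d - 1 = f * g" by blast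
      then have "int_poly_eval (X ^ d - 1) z = 0" using f by (simp add: int_poly_eval_mult)
      then show False using primitive_root_of_unity[of d n] d
        by (simp add: X_pow int_poly_eval_monom_minus_1 z_def)
    qed
    then have "f dvd h" using f h prime_dvd_mult_iff by metis
    then have hP: "h \<in> P" by (rule dvd_mem)
    \<comment> \<open>By the product rule the derivative lies in \<open>P\<close>, although neither
      \<open>n\<close> nor \<open>X\<close> does.\<close>
    have "of_nat n * X ^ (n - 1) = pderiv (X ^ n - 1)"
      by (simp add: X_pow pderiv_diff pderiv_monom of_nat_monom mult_monom)
    also have "\<dots> = pderiv h * (X ^ d - 1) + pderiv (X ^ d - 1) * h"
      unfolding h by (simp only: pderiv_mult mult.commute)
    also have "\<dots> \<in> P" using Xd hP by (intro add_mem mult_mem) (auto simp: eqv_def)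
    finally have "X ^ (n - 1) \<in> P" using nP prime_mem by blast
    then have "X * X ^ (n - 1) \<in> P" by (rule mult_mem)
    then have "X ^ n \<in> P" using n power_minus_mult[of n X] by (simp add: mult.commute)
    then show False using Xn one_notin eqv_mem_iff by blast
  qed
  \<comment> \<open>The least positive exponent \<open>d\<close> with \<open>X ^ d\<close> congruent
    to 1 divides \<open>n\<close>, which reduces the claim to divisors of \<open>n\<close>.\<close>
  have order: "\<not> eqv (X ^ i) 1" if i: "0 < i" "i < n" for i
  proof
    assume Xi: "eqv (X ^ i) 1"
    define d where "d = (LEAST j. j > 0 \<and> eqv (X ^ j) 1)"
    have d: "d > 0" "eqv (X ^ d) 1"
      using LeastI[of "\<lambda>j. j > 0 \<and> eqv (X ^ j) 1" i] i Xi unfolding d_def by auto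
    have "d \<le> i" unfolding d_def using i Xi by (intro Least_le) simp
    have "eqv (X ^ (n mod d)) 1"
    proof -
      have "eqv 1 (X ^ n)" by (rule eqv_sym[OF Xn])
      also have "X ^ n = (X ^ d) ^ (n div d) * X ^ (n mod d)"
        by (simp flip: power_mult power_add)
      also have "eqv \<dots> (1 ^ (n div d) * X ^ (n mod d))"
        by (intro eqv_mult eqv_power d eqv_refl)
      finally show ?thesis by (simp add: eqv_sym)
    qed
    moreover have "n mod d < d" using d by simp
    ultimately have "n mod d = 0"
      using not_less_Least[of "n mod d" "\<lambda>j. j > 0 \<and> eqv (X ^ j) 1"] unfolding d_def by auto
    then show False using no_divisor[of d] d \<open>d \<le> i\<close> i by auto
  qed
  \<comment> \<open>Index 0 stands for the zero class, and the indices \<open>1, ..., q - 1\<close>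
    for the \<open>n\<close> powers of \<open>X\<close>, shifted by one.\<close>
  define r where "r i = (if i = 0 then 0 else X ^ (i - 1))" for i
  have X_pow_notin: "X ^ i \<notin> P" for i
  proof (induction i)
    case 0 then show ?case using one_notin by simp
  next
    case (Suc i) then show ?case using XP prime_mem by auto
  qed
  have X_pow_inj: "i = j" if "i \<le> j" "j < n" "eqv (X ^ i) (X ^ j)" for i j
  proof (rule ccontr)
    assume "i \<noteq> j"
    have "eqv (X ^ i * X ^ (j - i)) (X ^ i * 1)"
      using that eqv_sym by (simp flip: power_add)
    then have "eqv (X ^ (j - i)) 1" using eqv_mult_cancel X_pow_notin by blast
    then show False using order[of "j - i"] that \<open>i \<noteq> j\<close> by simp
  qed
  have r_inj: "i = j" if ij: "i < q" "j < q" "eqv (r i) (r j)" for i j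
  proof (cases "i = 0 \<or> j = 0")
    case True
    then show ?thesis using ij X_pow_notin eqv_zero_iff eqv_sym
      unfolding r_def by (metis (full_types))
  next
    case False
    then have e: "eqv (X ^ (i - 1)) (X ^ (j - 1))" "i - 1 < n" "j - 1 < n"
      using ij n by (auto simp: r_def)
    have "i - 1 = j - 1"
      using X_pow_inj[OF _ e(3,1)] X_pow_inj[OF _ e(2) eqv_sym[OF e(1)]]
      by (cases "i - 1 \<le> j - 1") auto
    then show ?thesis using False by arith
  qed
  have X_frob: "eqv (X ^ q) X"
    using eqv_mult[OF eqv_refl Xn, of X] by (simp add: n)
  \<comment> \<open>The \<open>q\<close>-th power is additive and multiplicative modulo
    \<open>P\<close> and fixes the integers and \<open>X\<close>, hence every integer
    polynomial.\<close>
  have frob: "eqv (g ^ q) g" for g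
  proof (induction g)
    case 0
    then show ?case using q1 by (simp add: power_0_left)
  next
    case (pCons c g)
    have eq: "pCons c g = of_int c + X * g"
      by (simp add: X_def of_int_poly monom_altdef)
    have "eqv (pCons c g ^ q) (of_int c ^ q + (X * g) ^ q)"
      unfolding eq q_def by (rule frobenius_pow_add)
    also have "(X * g) ^ q = X ^ q * g ^ q" by (rule power_mult_distrib)
    also have "eqv (of_int c ^ q + X ^ q * g ^ q) (of_int c + X * g)"
      using fermat_of_int[of c k] by (intro eqv_add eqv_mult X_frob pCons.IH) (simp add: q_def)
    finally show ?case unfolding eq .
  qed
  have "finite_residue_field P p k q r"
    by standard (use k q_def frob r_inj in auto)
  then show ?thesis unfolding q_def by blast
qed

section \<open>Weighing matrices from additive characters\<close>

locale additive_character = finite_residue_field P p k q r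
  for P :: "'a :: comm_ring_1 set" and p k q r +
  fixes \<psi> :: "'a \<Rightarrow> complex"
  assumes psi_add: "\<psi> (x + y) = \<psi> x * \<psi> y"
    and psi_mem: "x \<in> P \<Longrightarrow> \<psi> x = 1"
    and psi_nontrivial: "\<exists>x. \<psi> x \<noteq> 1"
    and psi_power: "\<psi> x ^ q = 1"
begin

section \<open>Values and orthogonality of the character\<close>

lemma psi_eqv: "x \<approx> y \<Longrightarrow> \<psi> x = \<psi> y"
  using psi_add[of y "x - y"] psi_mem[of "x - y"] by (simp add: eqv_def)

lemma norm_psi: "cmod (\<psi> x) = 1"
proof -
  have "cmod (\<psi> x) ^ q = 1 ^ q" by (simp add: psi_power flip: norm_power)
  then show ?thesis using q_gt_1 by (intro power_eq_imp_eq_base[of _ q 1]) auto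
qed

lemma cnj_psi: "cnj (\<psi> x) = \<psi> (- x)"
proof -
  have "\<psi> x * \<psi> (- x) = 1" using psi_add[of x "- x"] psi_mem[OF zero_mem] by simp
  moreover have "\<psi> x * cnj (\<psi> x) = 1" by (simp add: complex_norm_square[symmetric] norm_psi)
  moreover have "\<psi> x \<noteq> 0" using norm_psi[of x] by auto
  ultimately show ?thesis by (metis mult_left_cancel)
qed

lemma psi_mult_cnj: "\<psi> x * cnj (\<psi> y) = \<psi> (x - y)"
  by (simp add: cnj_psi flip: psi_add)

lemma r_diff_mem_iff: "i < q \<Longrightarrow> j < q \<Longrightarrow> r i - r j \<in> P \<longleftrightarrow> i = j"
  using r_inj[of i j] zero_mem by (auto simp: eqv_def)

lemma character_sum: "(\<Sum>x<q. \<psi> (c * r x)) = (if c \<in> P then of_nat q else 0)"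
proof (cases "c \<in> P")
  case True
  then have "\<psi> (c * r x) = 1" for x
    using mult_mem[of c "r x"] by (intro psi_mem) (simp add: mult.commute)
  then show ?thesis using True by simp
next
  case False
  obtain u where u: "\<psi> u \<noteq> 1" using psi_nontrivial by blast
  obtain d where d: "d * c \<approx> 1" using inverse_ex[OF False] by blast
  \<comment> \<open>Translation by \<open>t\<close> permutes the classes and multiplies the sum by
    \<open>\<psi> (c * t)\<close>, which differs from 1; so the sum is 0. The map \<open>s\<close>
    below is this translation on indices.\<close>
  define t where "t = d * u"
  have "c * t \<approx> u"
    using eqv_mult[OF d eqv_refl, of u] by (simp add: t_def mult_ac)
  then have ct: "\<psi> (c * t) \<noteq> 1" using u psi_eqv by metis
  have "\<forall>x. \<exists>y<q. r x + t \<approx> r y" using r_surj by blast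
  then obtain s where s: "\<And>x. s x < q" "\<And>x. r x + t \<approx> r (s x)" by metis
  have inj: "inj_on s {..<q}"
  proof (rule inj_onI)
    fix x y assume xy: "x \<in> {..<q}" "y \<in> {..<q}" "s x = s y"
    have "r x + t \<approx> r y + t" using s(2)[of x] s(2)[of y] xy(3) eqv_sym eqv_trans by metis
    then show "x = y" using xy r_inj by (simp add: eqv_def)
  qed
  have "s ` {..<q} = {..<q}"
    using s(1) inj by (intro endo_inj_surj) auto
  then have "(\<Sum>x<q. \<psi> (c * r x)) = (\<Sum>x<q. \<psi> (c * r (s x)))"
    using sum.reindex[OF inj, of "\<lambda>x. \<psi> (c * r x)"] by simp
  also have "\<dots> = (\<Sum>x<q. \<psi> (c * t) * \<psi> (c * r x))"
  proof (rule sum.cong)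
    fix x
    have "\<psi> (c * r (s x)) = \<psi> (c * (r x + t))"
      by (intro psi_eqv eqv_mult eqv_refl eqv_sym[OF s(2)])
    also have "\<dots> = \<psi> (c * t) * \<psi> (c * r x)" by (simp add: distrib_left psi_add)
    finally show "\<psi> (c * r (s x)) = \<psi> (c * t) * \<psi> (c * r x)" .
  qed simp
  also have "\<dots> = \<psi> (c * t) * (\<Sum>x<q. \<psi> (c * r x))"
    by (rule sum_distrib_left [symmetric])
  finally have "(\<Sum>x<q. \<psi> (c * r x)) = \<psi> (c * t) * (\<Sum>x<q. \<psi> (c * r x))" .
  then show ?thesis using ct False by simp
qed

lemma sum_square_div_mod: "(\<Sum>l<q\<^sup>2. g (l div q) (l mod q)) = (\<Sum>x<q. \<Sum>y<q. g x y :: complex)"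
proof -
  have "(\<Sum>x<q. \<Sum>y<q. g x y) = (\<Sum>(x, y)\<in>{..<q} \<times> {..<q}. g x y)"
    by (simp add: sum.cartesian_product)
  also have "\<dots> = (\<Sum>l<q\<^sup>2. g (l div q) (l mod q))"
  proof (rule sum.reindex_bij_witness[of _ "\<lambda>l. (l div q, l mod q)" "\<lambda>(x, y). x * q + y"])
    fix l assume "l \<in> {..<q\<^sup>2}"
    then show "(l div q, l mod q) \<in> {..<q} \<times> {..<q}"
      using q_gt_1 by (simp add: power2_eq_square less_mult_imp_div_less)
  next
    fix xy assume "xy \<in> {..<q} \<times> {..<q}"
    then obtain x y where xy: "xy = (x, y)" "x < q" "y < q" by auto
    have "x * q + y < Suc x * q" using xy by simp
    also have "\<dots> \<le> q * q" using xy by (intro mult_right_mono) auto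
    finally show "(case xy of (x, y) \<Rightarrow> x * q + y) \<in> {..<q\<^sup>2}" using xy by (simp add: power2_eq_square)
  qed auto
  finally show ?thesis by simp
qed

text \<open>Row \<open>s\<close> encodes the pair (frequency, intercept) and column \<open>l\<close>
  the point (x, y), each as quotient and remainder by \<open>q\<close>; the slope is
  \<open>r m\<close>.\<close>

definition weighing :: "nat \<Rightarrow> cmat" where
  "weighing m s l = (if r (l mod q) \<approx> r m * r (l div q) + r (s mod q)
     then \<psi> (r (s div q) * r (l div q)) else 0)"

text \<open>Exactly one index below \<open>q\<close> represents the class of
  \<open>a\<close>.\<close>

lemma sum_on_class:
  "(\<Sum>y<q. (if r y \<approx> a then u y else 0)) = (u (SOME y. y < q \<and> r y \<approx> a) :: complex)"
proof -
  define z where "z = (SOME y. y < q \<and> r y \<approx> a)"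
  have z: "z < q" "r z \<approx> a"
    using someI_ex[of "\<lambda>y. y < q \<and> r y \<approx> a"] r_surj[of a] eqv_sym unfolding z_def by blast+
  have "(\<Sum>y<q. (if r y \<approx> a then u y else 0)) = (\<Sum>y<q. if y = z then u y else 0)"
  proof (rule sum.cong)
    fix y assume "y \<in> {..<q}"
    then have "r y \<approx> a \<longleftrightarrow> y = z"
      using z r_inj[of y z] eqv_trans[OF _ eqv_sym[OF z(2)]] by auto
    then show "(if r y \<approx> a then u y else 0) = (if y = z then u y else 0)" by simp
  qed simp
  then show ?thesis using z by (simp add: z_def)
qed

text \<open>For each \<open>x\<close> the two lines have one point each above \<open>x\<close>; a
  contribution arises only where these points coincide.\<close>

lemma weighing_product:
  "mat_mult (q\<^sup>2) (weighing m) (conj_transp (weighing m')) s t =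
     (\<Sum>x<q. if r m * r x + r (s mod q) \<approx> r m' * r x + r (t mod q)
        then \<psi> ((r (s div q) - r (t div q)) * r x) else 0)"
proof -
  define g where "g x y =
    (if r y \<approx> r m * r x + r (s mod q) then \<psi> (r (s div q) * r x) else 0) *
    cnj (if r y \<approx> r m' * r x + r (t mod q) then \<psi> (r (t div q) * r x) else 0)" for x y
  have "mat_mult (q\<^sup>2) (weighing m) (conj_transp (weighing m')) s t
      = (\<Sum>l<q\<^sup>2. g (l div q) (l mod q))"
    by (simp add: mat_mult_def conj_transp_def weighing_def g_def)
  also have "\<dots> = (\<Sum>x<q. \<Sum>y<q. g x y)" by (rule sum_square_div_mod)
  also have "\<dots> = (\<Sum>x<q. if r m * r x + r (s mod q) \<approx> r m' * r x + r (t mod q)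
        then \<psi> ((r (s div q) - r (t div q)) * r x) else 0)"
  proof (rule sum.cong)
    fix x
    let ?A = "r m * r x + r (s mod q)" and ?B = "r m' * r x + r (t mod q)"
    have "g x y = (if r y \<approx> ?A then (if ?A \<approx> ?B
        then \<psi> ((r (s div q) - r (t div q)) * r x) else 0) else 0)" for y
    proof (cases "r y \<approx> ?A")
      case True
      then have "r y \<approx> ?B \<longleftrightarrow> ?A \<approx> ?B" using eqv_sym eqv_trans by blast
      then show ?thesis using True by (simp add: g_def psi_mult_cnj left_diff_distrib)
    qed (simp add: g_def)
    then show "(\<Sum>y<q. g x y) = (if ?A \<approx> ?B then \<psi> ((r (s div q) - r (t div q)) * r x) else 0)"
      by (simp add: sum_on_class)
  qed simp
  finally show ?thesis .
qed

lemma div_mod_less: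
  assumes "s < q\<^sup>2" shows "s div q < q" "s mod q < q"
  using assms q_gt_1 by (auto simp: power2_eq_square less_mult_imp_div_less)

lemma div_mod_eq_iff: "s div q = t div q \<and> s mod q = t mod q \<longleftrightarrow> s = t"
  by (metis div_mult_mod_eq)

lemma unit_weighing_weighing: "unit_weighing (q\<^sup>2) q (weighing m)"
  unfolding unit_weighing_def
proof (intro conjI allI impI)
  fix s t assume s: "s < q\<^sup>2" and t: "t < q\<^sup>2"
  show "weighing m s t = 0 \<or> cmod (weighing m s t) = 1" by (simp add: weighing_def norm_psi)
  \<comment> \<open>Lines of equal slope coincide or are disjoint, so a full character sum remains
    for equal intercepts and nothing otherwise.\<close>
  have "(r m * r x + r (s mod q) \<approx> r m * r x + r (t mod q)) \<longleftrightarrow> s mod q = t mod q" for x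
    using r_diff_mem_iff[of "s mod q" "t mod q"] div_mod_less s t by (simp add: eqv_def)
  then have "mat_mult (q\<^sup>2) (weighing m) (conj_transp (weighing m)) s t =
      (if s mod q = t mod q then \<Sum>x<q. \<psi> ((r (s div q) - r (t div q)) * r x) else 0)"
    by (simp add: weighing_product)
  also have "\<dots> = (if s = t then of_nat q else 0)"
    using div_mod_eq_iff[of s t] div_mod_less s t psi_mem[OF zero_mem] by (auto simp: character_sum r_diff_mem_iff)
  finally show "mat_mult (q\<^sup>2) (weighing m) (conj_transp (weighing m)) s t
      = (if s = t then of_nat q else 0)" .
qed

text \<open>Two lines of distinct slopes meet in one point, whose abscissa is \<open>d\<close> times
  the difference of the intercepts. Here \<open>d\<close> inverts the difference of the slopes and
  so is the same for all \<open>s\<close> and \<open>t\<close>.\<close>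

lemma weighing_product_distinct:
  assumes "m < q" "m' < q" "m \<noteq> m'"
  shows "\<exists>d. d \<notin> P \<and> (\<forall>s t. mat_mult (q\<^sup>2) (weighing m) (conj_transp (weighing m')) s t =
    \<psi> ((r (s div q) - r (t div q)) * (d * (r (t mod q) - r (s mod q)))))"
proof -
  have c: "r m - r m' \<notin> P" using assms r_diff_mem_iff by simp
  then obtain d where d: "d * (r m - r m') \<approx> 1" using inverse_ex by blast
  have dP: "d \<notin> P"
  proof
    assume "d \<in> P"
    then have "(r m - r m') * d \<in> P" by (rule mult_mem)
    then show False using eqv_mem_iff[OF d] one_notin by (simp add: mult.commute)
  qed
  have "mat_mult (q\<^sup>2) (weighing m) (conj_transp (weighing m')) s t =
    \<psi> ((r (s div q) - r (t div q)) * (d * (r (t mod q) - r (s mod q))))" for s t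
  proof -
    let ?D = "r (s div q) - r (t div q)" and ?x = "d * (r (t mod q) - r (s mod q))"
    have "(r m * r x + r (s mod q) \<approx> r m' * r x + r (t mod q)) \<longleftrightarrow> r x \<approx> ?x" for x
    proof -
      have "(r m * r x + r (s mod q) \<approx> r m' * r x + r (t mod q)) \<longleftrightarrow>
          (r m - r m') * r x \<approx> r (t mod q) - r (s mod q)"
        by (simp add: eqv_def algebra_simps)
      also have "\<dots> \<longleftrightarrow> d * ((r m - r m') * r x) \<approx> ?x"
        using eqv_mult_cancel[OF dP] eqv_mult[OF eqv_refl] by blast
      also have "\<dots> \<longleftrightarrow> r x \<approx> ?x"
      proof -
        have "d * ((r m - r m') * r x) \<approx> r x"
          using eqv_mult[OF d eqv_refl, of "r x"] by (simp add: mult.assoc)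
        then show ?thesis using eqv_sym eqv_trans by blast
      qed
      finally show ?thesis .
    qed
    then have "mat_mult (q\<^sup>2) (weighing m) (conj_transp (weighing m')) s t
        = (\<Sum>x<q. if r x \<approx> ?x then \<psi> (?D * r x) else 0)"
      by (simp add: weighing_product)
    also have "\<dots> = (\<Sum>x<q. if r x \<approx> ?x then \<psi> (?D * ?x) else 0)"
      by (intro sum.cong if_cong psi_eqv eqv_mult eqv_refl) auto
    also have "\<dots> = \<psi> (?D * ?x)" by (simp add: sum_on_class)
    finally show ?thesis .
  qed
  then show ?thesis using dP by blast
qed

section \<open>Matrices with entries \<open>\<psi>((i - j) d (b - a))\<close> at rows
  \<open>(i, a)\<close> and columns \<open>(j, b)\<close>\<close>

context
  fixes d :: 'a and H :: cmat
  assumes d: "d \<notin> P"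
    and H: "\<And>s t. H s t = \<psi> ((r (s div q) - r (t div q)) * (d * (r (t mod q) - r (s mod q))))"
begin

lemma diff_mult_mem_iff: "i < q \<Longrightarrow> j < q \<Longrightarrow> d * (r i - r j) \<in> P \<longleftrightarrow> i = j"
  using prime_mem[of d "r i - r j"] d mult_mem[of "r i - r j" d] by (auto simp: r_diff_mem_iff)

lemma complex_hadamard_character: "complex_hadamard (q\<^sup>2) H"
  unfolding complex_hadamard_def unit_weighing_def
proof (intro conjI allI impI)
  fix s t assume s: "s < q\<^sup>2" and t: "t < q\<^sup>2"
  show "H s t = 0 \<or> cmod (H s t) = 1" by (simp add: H norm_psi)
  define i a i' a' where "i = s div q" "a = s mod q" "i' = t div q" "a' = t mod q"
  note defs = this
  have less: "i < q" "a < q" "i' < q" "a' < q"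
    using div_mod_less s t by (simp_all add: defs)
  define K where "K = d * (r i' * r a' - r i * r a)"
  \<comment> \<open>In the difference of the two exponents the terms in \<open>j * b\<close> cancel.
    What is left is a constant \<open>K\<close> plus a part linear in \<open>j\<close> and a part
    linear in \<open>b\<close>, so the double sum factors into two character sums.\<close>
  define g where "g j b = \<psi> K * (\<psi> (d * (r a - r a') * r j) * \<psi> (d * (r i - r i') * r b))" for j b
  have "H s l * cnj (H t l) = g (l div q) (l mod q)" for l
    unfolding H g_def psi_mult_cnj psi_add[symmetric] K_def defs
    by (rule arg_cong[of _ _ \<psi>]) (simp add: algebra_simps)
  then have "mat_mult (q\<^sup>2) H (conj_transp H) s t = (\<Sum>l<q\<^sup>2. g (l div q) (l mod q))"
    by (simp add: mat_mult_def conj_transp_def)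
  also have "\<dots> = (\<Sum>j<q. \<Sum>b<q. g j b)" by (rule sum_square_div_mod)
  also have "\<dots> = \<psi> K * ((\<Sum>j<q. \<psi> (d * (r a - r a') * r j)) * (\<Sum>b<q. \<psi> (d * (r i - r i') * r b)))"
    unfolding g_def sum_product by (simp add: sum_distrib_left)
  also have "\<dots> = (if a = a' \<and> i = i' then of_nat (q\<^sup>2) else 0)"
    using psi_mem[OF zero_mem]
    by (auto simp: character_sum diff_mult_mem_iff less power2_eq_square K_def)
  also have "\<dots> = (if s = t then of_nat (q\<^sup>2) else 0)"
    using div_mod_eq_iff[of s t] by (auto simp: defs)
  finally show "mat_mult (q\<^sup>2) H (conj_transp H) s t = (if s = t then of_nat (q\<^sup>2) else 0)" .
qed

text \<open>The exponent vanishes for \<open>i = j\<close>. For \<open>i \<noteq> j\<close>, fixing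
  \<open>a\<close> or \<open>b\<close> leaves a constant times a full character sum with coefficient
  outside \<open>P\<close>.\<close>

lemma bush_type_character: "bush_type q H"
  unfolding bush_type_def
proof (intro conjI allI impI)
  show "complex_hadamard (q\<^sup>2) H" by (rule complex_hadamard_character)
  have block: "H (i * q + a) (j * q + b) = \<psi> ((r i - r j) * (d * (r b - r a)))"
    if "a < q" "b < q" for i j a b
    using that by (simp add: H)
  fix i j assume ij: "i < q" "j < q"
  {
    fix a b assume "a < q" "b < q"
    then show "H (i * q + a) (i * q + b) = 1" using psi_mem[OF zero_mem] by (simp add: block)
  }
  assume "i \<noteq> j"
  then have notin: "d * (r i - r j) \<notin> P" "d * (r j - r i) \<notin> P"
    using ij by (auto simp: diff_mult_mem_iff)
  {
    fix a assume "a < q"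
    then have "(\<Sum>b<q. H (i * q + a) (j * q + b))
        = (\<Sum>b<q. \<psi> (- (d * (r i - r j) * r a)) * \<psi> (d * (r i - r j) * r b))"
      by (intro sum.cong) (simp_all add: block psi_add [symmetric], simp add: algebra_simps)
    also have "\<dots> = 0" using notin by (simp add: character_sum flip: sum_distrib_left)
    finally show "(\<Sum>b<q. H (i * q + a) (j * q + b)) = 0" .
  next
    fix b assume "b < q"
    then have "(\<Sum>a<q. H (i * q + a) (j * q + b))
        = (\<Sum>a<q. \<psi> (d * (r i - r j) * r b) * \<psi> (d * (r j - r i) * r a))"
      by (intro sum.cong) (simp_all add: block psi_add [symmetric], simp add: algebra_simps)
    also have "\<dots> = 0" using notin by (simp add: character_sum flip: sum_distrib_left)
    finally show "(\<Sum>a<q. H (i * q + a) (j * q + b)) = 0" .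
  }
qed

lemma butson_hadamard_character: "butson_hadamard (q\<^sup>2) q H"
  unfolding butson_hadamard_def using complex_hadamard_character by (simp add: H psi_power)

end

lemma weighing_family:
  assumes "m < q" "m' < q" "m \<noteq> m'"
  defines "H \<equiv> mat_mult (q\<^sup>2) (weighing m) (conj_transp (weighing m'))"
  shows "quasi_unbiased (q\<^sup>2) q (q\<^sup>2) 1 (weighing m) (weighing m') \<and>
    bush_type q H \<and> butson_hadamard (q\<^sup>2) q H"
proof -
  obtain d where d: "d \<notin> P"
    and H: "\<And>s t. H s t = \<psi> ((r (s div q) - r (t div q)) * (d * (r (t mod q) - r (s mod q))))"
    using weighing_product_distinct[OF assms(1-3)] unfolding H_def by blast
  have "unit_weighing (q\<^sup>2) (q\<^sup>2) H"
    using complex_hadamard_character[OF d H] by (simp add: complex_hadamard_def)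
  then have "quasi_unbiased (q\<^sup>2) q (q\<^sup>2) 1 (weighing m) (weighing m')"
    by (simp add: quasi_unbiased_def unit_weighing_weighing mat_scale_def H_def)
  then show ?thesis
    using bush_type_character[OF d H] butson_hadamard_character[OF d H] by blast
qed

end

theorem theorem6p3:
  fixes q :: nat
  assumes "prime_power q"
  shows "\<exists>W :: nat \<Rightarrow> cmat.
           (\<forall>i\<in>{1..q}. unit_weighing (q^2) q (W i)) \<and>
           (\<forall>i\<in>{1..q}. \<forall>j\<in>{1..q}. i \<noteq> j \<longrightarrow>
              quasi_unbiased (q^2) q (q^2) 1 (W i) (W j) \<and>
              bush_type q (mat_mult (q^2) (W i) (conj_transp (W j))) \<and>
              butson_hadamard (q^2) q (mat_mult (q^2) (W i) (conj_transp (W j))))"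
proof -
  obtain p k where p: "prime p" and k: "k \<ge> 1" and q: "q = p ^ k"
    using assms unfolding prime_power_def by blast
  obtain P :: "int poly set" and r where "finite_residue_field P p k q r"
    using finite_residue_field_exists[OF p k] q by blast
  then interpret finite_residue_field P p k q r .
  obtain \<psi> :: "int poly \<Rightarrow> complex" where
    "\<forall>x y. \<psi> (x + y) = \<psi> x * \<psi> y" "\<forall>x\<in>P. \<psi> x = 1" "\<exists>x. \<psi> x \<noteq> 1" "\<forall>x. \<psi> x ^ q = 1"
    using additive_character_ex by blast
  then interpret additive_character P p k q r \<psi>
    by unfold_locales auto
  show ?thesis
  \<comment> \<open>The matrices are numbered from 1 to \<open>q\<close>, the slopes from 0 to
    \<open>q - 1\<close>.\<close>
  proof (intro exI[of _ "\<lambda>i. weighing (i - 1)"] conjI ballI impI)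
    fix i j assume "i \<in> {1..q}" "j \<in> {1..q}" "i \<noteq> j"
    then have "i - 1 < q" "j - 1 < q" "i - 1 \<noteq> j - 1" by auto
    note * = weighing_family[OF this]
    show "quasi_unbiased (q^2) q (q^2) 1 (weighing (i - 1)) (weighing (j - 1))"
      "bush_type q (mat_mult (q^2) (weighing (i - 1)) (conj_transp (weighing (j - 1))))"
      "butson_hadamard (q^2) q (mat_mult (q^2) (weighing (i - 1)) (conj_transp (weighing (j - 1))))"
      using * by blast+
  qed (rule unit_weighing_weighing)
qed

end
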